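(* Let $I$ be an interval with $\inf I=0$, let $\mathscr{M}$ be a symmetric, monotone and Jensen concave $\mathbb{Q}$-weighted mean on $I$, and let $\lambda\in V(\mathbb{Q})$. Define $$\mathscr{C}_\lambda(\mathscr{M}):=\sup_{y>0}\ \liminf_{n\to\infty}\ \frac{\lambda_1+\cdots+\lambda_n}{y}\cdot\mathscr{M}\Big(\Big(\tfrac{y}{\lambda_1},\tfrac{y}{\lambda_1+\lambda_2},\dots,\tfrac{y}{\lambda_1+\cdots+\lambda_n}\Big),(\lambda_1,\dots,\lambda_n)\Big).$$ Then $\mathscr{H}_\lambda(\mathscr{M})\le\mathscr{C}_\lambda(\mathscr{M})$. Furthermore, if $\sum_{n=1}^\infty\lambda_n=\infty$, then $\mathscr{H}_\lambda(\mathscr{M})=\mathscr{C}_\lambda(\mathscr{M})$.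
   Context: For an interval $I\subseteq\mathbb{R}$ and a ring $R\subseteq\mathbb{R}$ (here $R=\mathbb{Q}$), let $W_n(R)=\{(\lambda_1,\dots,\lambda_n)\in R^n:\lambda_1,\dots,\lambda_n\ge0,\ \lambda_1+\cdots+\lambda_n>0\}$. An $R$-weighted mean on $I$ is a function $\mathscr{M}:\bigcup_{n\ge1}I^n\times W_n(R)\to I$ such that for all $n$: (1) nullhomogeneity in the weights: $\mathscr{M}(x,\lambda)=\mathscr{M}(x,t\lambda)$ for all $x\in I^n$, $\lambda\in W_n(R)$ and $t\in R$, $t>0$; (2) reduction principle: $\mathscr{M}(x,\lambda+\mu)=\mathscr{M}(x\odot x,\lambda\odot\mu)$ for all $x\in I^n$, $\lambda,\mu\in W_n(R)$, where $(p_1,\dots,p_n)\odot(q_1,\dots,q_n):=(p_1,q_1,\dots,p_n,q_n)$; (3) mean value property: $\min_i x_i\le\mathscr{M}(x,\lambda)\le\max_i x_i$ for all $x\in I^n$, $\lambda\in W_n(R)$; (4) elimination principle: if $\lambda_j=0$, then $\mathscr{M}(x,\lambda)$ is unchanged when the $j$-th entry of both $x$ and $\lambda$ is deleted. $\mathscr{M}$ is symmetric if $\mathscr{M}(x,\lambda)=\mathscr{M}(x\circ\sigma,\lambda\circ\sigma)$ for all $n$, $x\in I^n$, $\lambda\in W_n(R)$ and permutations $\sigma\in S_n$. It is monotone if $\mathscr{M}(x,\lambda)$ is nondecreasing in each variable $x_i$. It is Jensen concave if $\mathscr{M}(\frac{x+y}2,\lambda)\ge\frac12(\mathscr{M}(x,\lambda)+\mathscr{M}(y,\lambda))$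 for all $n$, $x,y\in I^n$, $\lambda\in W_n(R)$. $V(R)$ is the set of sequences $\lambda=(\lambda_n)_{n=1}^\infty$ in $R$ with $\lambda_1>0$, $\lambda_n\ge0$ for all $n\ge2$, and such that the sequence $\big(\frac{\lambda_n}{\lambda_1+\cdots+\lambda_n}\big)_{n=1}^\infty$ is nonincreasing. For a sequence $\lambda$ in $R$ with $\lambda_1>0$ and $\lambda_n\ge0$ for $n\ge2$, the $\lambda$-Hardy constant $\mathscr{H}_\lambda(\mathscr{M})$ is the smallest extended real number $C$ such that $\sum_{n=1}^\infty\lambda_n\,\mathscr{M}((x_1,\dots,x_n),(\lambda_1,\dots,\lambda_n))\le C\sum_{n=1}^\infty\lambda_nx_n$ for all sequences $(x_n)$ in $I$. *)

theory Defs
  imports "HOL-Analysis.Analysis" "HOL-Combinatorics.Permutations"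
begin

text \<open>
  Vectors of length n are lists, indexed from 0; a mean is a function of the list of
  entries and the list of weights, whose values are only constrained on I^n x W_n(R).
  The requirement n >= 1 is implied by the positivity of the sum of the weights.
\<close>

definition weight_vectors :: "real set \<Rightarrow> nat \<Rightarrow> real list set" where
  "weight_vectors R n =
    {ws. length ws = n \<and> set ws \<subseteq> R \<and> (\<forall>w\<in>set ws. 0 \<le> w) \<and> 0 < sum_list ws}"

definition vectors :: "real set \<Rightarrow> nat \<Rightarrow> real list set" where
  "vectors I n = {xs. length xs = n \<and> set xs \<subseteq> I}"

definition delete_nth :: "nat \<Rightarrow> 'a list \<Rightarrow> 'a list" where
  "delete_nth j xs = take j xs @ drop (Suc j) xs"

text \<open>
  For lists of equal length, the library function \<^const>\<open>splice\<close> is the interleaving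
  (p1, q1, ..., pn, qn) of the reduction principle.
\<close>

definition weighted_mean ::
    "real set \<Rightarrow> real set \<Rightarrow> (real list \<Rightarrow> real list \<Rightarrow> real) \<Rightarrow> bool" where
  "weighted_mean R I M \<longleftrightarrow>
    (\<forall>n. \<forall>xs\<in>vectors I n. \<forall>ws\<in>weight_vectors R n. M xs ws \<in> I) \<and>
    (\<forall>n. \<forall>xs\<in>vectors I n. \<forall>ws\<in>weight_vectors R n. \<forall>t\<in>R. 0 < t \<longrightarrow>
      M xs ws = M xs (map (\<lambda>w. t * w) ws)) \<and>
    (\<forall>n. \<forall>xs\<in>vectors I n. \<forall>ws\<in>weight_vectors R n. \<forall>vs\<in>weight_vectors R n.
      M xs (map2 (+) ws vs) = M (splice xs xs) (splice ws vs)) \<and>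
    (\<forall>n. \<forall>xs\<in>vectors I n. \<forall>ws\<in>weight_vectors R n.
      Min (set xs) \<le> M xs ws \<and> M xs ws \<le> Max (set xs)) \<and>
    (\<forall>n. \<forall>xs\<in>vectors I n. \<forall>ws\<in>weight_vectors R n. \<forall>j<n. ws ! j = 0 \<longrightarrow>
      M xs ws = M (delete_nth j xs) (delete_nth j ws))"

definition symmetric_mean ::
    "real set \<Rightarrow> real set \<Rightarrow> (real list \<Rightarrow> real list \<Rightarrow> real) \<Rightarrow> bool" where
  "symmetric_mean R I M \<longleftrightarrow>
    (\<forall>n. \<forall>xs\<in>vectors I n. \<forall>ws\<in>weight_vectors R n. \<forall>\<sigma>. \<sigma> permutes {..<n} \<longrightarrow>
      M xs ws = M (permute_list \<sigma> xs) (permute_list \<sigma> ws))"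

definition monotone_mean ::
    "real set \<Rightarrow> real set \<Rightarrow> (real list \<Rightarrow> real list \<Rightarrow> real) \<Rightarrow> bool" where
  "monotone_mean R I M \<longleftrightarrow>
    (\<forall>n. \<forall>xs\<in>vectors I n. \<forall>ws\<in>weight_vectors R n. \<forall>i<n. \<forall>u\<in>I.
      xs ! i \<le> u \<longrightarrow> M xs ws \<le> M (xs[i := u]) ws)"

definition jensen_concave_mean ::
    "real set \<Rightarrow> real set \<Rightarrow> (real list \<Rightarrow> real list \<Rightarrow> real) \<Rightarrow> bool" where
  "jensen_concave_mean R I M \<longleftrightarrow>
    (\<forall>n. \<forall>xs\<in>vectors I n. \<forall>ys\<in>vectors I n. \<forall>ws\<in>weight_vectors R n.
      M (map2 (\<lambda>x y. (x + y) / 2) xs ys) ws \<ge> (M xs ws + M ys ws) / 2)"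

text \<open>
  Sequences are indexed from 0, so l 0 is the first weight, and
  \<^term>\<open>\<Sum>k\<le>n. l k\<close> is the sum of the first n + 1 weights.
\<close>

definition V :: "real set \<Rightarrow> (nat \<Rightarrow> real) set" where
  "V R = {l. range l \<subseteq> R \<and> 0 < l 0 \<and> (\<forall>n\<ge>1. 0 \<le> l n) \<and>
             decseq (\<lambda>n. l n / (\<Sum>k\<le>n. l k))}"

definition prefix :: "(nat \<Rightarrow> 'a) \<Rightarrow> nat \<Rightarrow> 'a list" where
  "prefix x n = map x [0..<n]"

text \<open>
  Both series are taken in the extended reals; they have nonnegative terms whenever I
  consists of nonnegative numbers. Products follow the convention
  \<^prop>\<open>\<infinity> * (0::ereal) = 0\<close>.
\<close>

definition hardy_constant ::
    "real set \<Rightarrow> (real list \<Rightarrow> real list \<Rightarrow> real) \<Rightarrow> (nat \<Rightarrow> real) \<Rightarrow> ereal" where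
  "hardy_constant I M l = Inf {C. \<forall>x. range x \<subseteq> I \<longrightarrow>
      (\<Sum>n. ereal (l n * M (prefix x (Suc n)) (prefix l (Suc n))))
        \<le> C * (\<Sum>n. ereal (l n * x n))}"

text \<open>
  The supremum runs over those y > 0 for which the mean is defined, that is, for which all
  y / (l 0 + ... + l k) lie in I. If I is an interval with infimum 0 this just means that
  the largest of them, y / l 0, lies in I; it is no restriction when I is unbounded.
\<close>

definition C_const ::
    "real set \<Rightarrow> (real list \<Rightarrow> real list \<Rightarrow> real) \<Rightarrow> (nat \<Rightarrow> real) \<Rightarrow> ereal" where
  "C_const I M l = (SUP y\<in>{y. 0 < y \<and> (\<forall>k. y / (\<Sum>i\<le>k. l i) \<in> I)}.
      liminf (\<lambda>n. ereal ((\<Sum>k\<le>n. l k) / y *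
        M (prefix (\<lambda>k. y / (\<Sum>i\<le>k. l i)) (Suc n)) (prefix l (Suc n)))))"

end

theory Submission imports Defs
begin

text \<open>
  Write W n for the sum of the weights up to n and A n for the weighted arithmetic mean of
  the first entries up to n. The core is a Kedlaya inequality: the sum of l i M(x up to i) over
  i \<open>\<le>\<close> n is at most W n M(A up to n). It follows by induction on n from the step
  W (n + 1) M(A up to n + 1) \<open>\<ge>\<close> W n M(A up to n) + l (n + 1) M(x up to n + 1), a
  consequence of concavity since A j is a suitable convex combination of x j, A j and A (j - 1).
  If y bounds the sum of all l i x i, then A k \<open>\<le>\<close> y / W k, and monotonicity gives the upper
  bound. Conversely, testing the Hardy inequality with y / W k for k < N followed by a negligible
  tail shows that no smaller constant works, because the series of l k / W k diverges
  with that of l k.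
\<close>

subsection \<open>Means of lists of weighted points\<close>

lemma map_splice: "map f (splice xs ys) = splice (map f xs) (map f ys)"
  by (induction xs ys rule: splice.induct) auto

lemma mset_splice: "mset (splice xs ys) = mset xs + mset ys"
  by (induction xs ys rule: splice.induct) auto

text \<open>The mass at \<open>v\<close> of the discrete measure given by the list. By
  \<open>pair_mean_eqI\<close> the mean depends on this measure only.\<close>

definition weight_at :: "(real \<times> real) list \<Rightarrow> real \<Rightarrow> real" where
  "weight_at ps v = (\<Sum>p\<leftarrow>ps. if fst p = v then snd p else 0)"

locale concave_mean =
  fixes I :: "real set" and M :: "real list \<Rightarrow> real list \<Rightarrow> real"
  assumes conv: "convex I"
    and mean: "weighted_mean \<rat> I M"
    and symm: "symmetric_mean \<rat> I M"
    and conc: "jensen_concave_mean \<rat> I M"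
begin

lemma mean_in:
  assumes "xs \<in> vectors I n" "ws \<in> weight_vectors \<rat> n" shows "M xs ws \<in> I"
  using mean assms unfolding weighted_mean_def by (elim conjE) blast

lemma mean_bounds:
  assumes "xs \<in> vectors I n" "ws \<in> weight_vectors \<rat> n"
  shows "Min (set xs) \<le> M xs ws" "M xs ws \<le> Max (set xs)"
  using mean assms unfolding weighted_mean_def by (elim conjE; blast)+

lemma reduction:
  assumes "xs \<in> vectors I n" "ws \<in> weight_vectors \<rat> n" "vs \<in> weight_vectors \<rat> n"
  shows "M xs (map2 (+) ws vs) = M (splice xs xs) (splice ws vs)"
  using mean assms unfolding weighted_mean_def by blast

text \<open>Keeping each entry with its weight lets permutations and deletions act on a single
  list.\<close>

definition pair_mean :: "(real \<times> real) list \<Rightarrow> real" where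
  "pair_mean ps = M (map fst ps) (map snd ps)"

definition admissible :: "(real \<times> real) list \<Rightarrow> bool" where
  "admissible ps \<longleftrightarrow> (\<forall>p\<in>set ps. fst p \<in> I \<and> snd p \<in> \<rat> \<and> 0 \<le> snd p) \<and> 0 < sum_list (map snd ps)"

lemma admissible_vectors:
  assumes "admissible ps"
  shows "map fst ps \<in> vectors I (length ps)" "map snd ps \<in> weight_vectors \<rat> (length ps)"
  using assms by (auto simp: admissible_def vectors_def weight_vectors_def)

lemma admissible_perm:
  assumes "mset ps = mset qs" shows "admissible ps \<longleftrightarrow> admissible qs"
proof -
  have "mset (map snd ps) = mset (map snd qs)" using assms by simp
  then have "sum_list (map snd ps) = sum_list (map snd qs)"
    by (metis sum_mset_sum_list)
  then show ?thesis using mset_eq_setD[OF assms] by (simp add: admissible_def)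
qed

lemma pair_mean_perm:
  assumes "admissible ps" "mset ps = mset qs"
  shows "pair_mean ps = pair_mean qs"
proof -
  obtain p where p: "p permutes {..<length ps}" "permute_list p ps = qs"
    using mset_eq_permutation[of qs ps] assms(2) by metis
  have "M (map fst ps) (map snd ps) = M (permute_list p (map fst ps)) (permute_list p (map snd ps))"
    using symm admissible_vectors[OF assms(1)] p(1) unfolding symmetric_mean_def by blast
  then show ?thesis using p by (simp add: pair_mean_def permute_list_map)
qed

lemma pair_mean_zero:
  assumes "admissible ps" "x \<in> I"
  shows "pair_mean ((x, 0) # ps) = pair_mean ps"
proof -
  have a: "admissible ((x, 0) # ps)" using assms by (simp add: admissible_def)
  have "M (map fst ((x,0)#ps)) (map snd ((x,0)#ps)) =
     M (delete_nth 0 (map fst ((x,0)#ps))) (delete_nth 0 (map snd ((x,0)#ps)))"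
    using mean admissible_vectors[OF a] unfolding weighted_mean_def by fastforce
  then show ?thesis by (simp add: pair_mean_def delete_nth_def)
qed

lemma pair_mean_zeros:
  assumes "admissible ps" "set vs \<subseteq> I"
  shows "pair_mean (map (\<lambda>x. (x, 0)) vs @ ps) = pair_mean ps"
  using assms(2)
proof (induction vs)
  case (Cons v vs)
  have "admissible (map (\<lambda>x. (x, 0)) vs @ ps)"
    using assms(1) Cons.prems by (auto simp: admissible_def comp_def)
  then show ?case using Cons pair_mean_zero by simp
qed simp

lemma pair_mean_scale:
  assumes "admissible ps" "t \<in> \<rat>" "0 < t"
  shows "pair_mean (map (\<lambda>p. (fst p, t * snd p)) ps) = pair_mean ps"
proof -
  have "M (map fst ps) (map snd ps) = M (map fst ps) (map (\<lambda>w. t * w) (map snd ps))"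
    using mean admissible_vectors[OF assms(1)] assms(2,3) unfolding weighted_mean_def by blast
  then show ?thesis by (simp add: pair_mean_def comp_def)
qed

text \<open>The reduction principle doubles every point. To split only the first one, the second
  weight vector is taken to be zero elsewhere, and the spare points of weight zero are
  eliminated.\<close>

lemma pair_mean_split:
  assumes "admissible ((x, u + v) # ps)" "u \<in> \<rat>" "v \<in> \<rat>" "0 \<le> u" "0 \<le> v"
  shows "pair_mean ((x, u) # (x, v) # ps) = pair_mean ((x, u + v) # ps)"
proof -
  have x: "x \<in> I" using assms(1) by (simp add: admissible_def)
  \<comment> \<open>The reduction principle needs both weight vectors to have positive sum, so a
    vanishing \<open>u\<close> or \<open>v\<close> is left to elimination.\<close>
  consider "u = 0" | "v = 0" | "u > 0" "v > 0" using assms by fastforce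
  then show ?thesis
  proof cases
    case 1
    then show ?thesis using pair_mean_zero[OF assms(1) x] by simp
  next
    case 2
    have "admissible ((x, 0) # (x, u) # ps)" using assms(1) x 2 by (auto simp: admissible_def)
    then have "pair_mean ((x, 0) # (x, u) # ps) = pair_mean ((x, u) # (x, v) # ps)"
      by (rule pair_mean_perm) (simp add: 2)
    then show ?thesis using pair_mean_zero[OF assms(1) x] 2 by simp
  next
    case 3
    have s0: "sum_list (map snd ps) \<ge> 0"
      using assms(1) by (auto simp: admissible_def intro!: sum_list_nonneg)
    define zs where "zs = map (\<lambda>p. (fst p, 0::real)) ps"
    let ?us = "(x, u) # ps" and ?vs = "(x, v) # zs" and ?xs = "x # map fst ps"
    have zsz: "sum_list (map snd zs) = 0" by (simp add: zs_def comp_def)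
    have au: "admissible ?us" using assms(1,2) 3 s0 by (auto simp: admissible_def)
    have av: "admissible ?vs" using assms(1,3) 3 zsz by (auto simp: admissible_def zs_def)
    have "M ?xs (map2 (+) (map snd ?us) (map snd ?vs))
        = M (splice ?xs ?xs) (splice (map snd ?us) (map snd ?vs))"
      by (rule reduction[where n = "Suc (length ps)"])
        (use admissible_vectors[OF au] admissible_vectors[OF av] in \<open>simp_all add: zs_def\<close>)
    moreover have "map2 (+) (map snd ?us) (map snd ?vs) = map snd ((x, u + v) # ps)"
      by (auto simp: zs_def intro!: nth_equalityI)
    moreover have "splice ?xs ?xs = map fst (splice ?us ?vs)"
      by (simp add: map_splice zs_def comp_def)
    ultimately have "pair_mean ((x, u + v) # ps) = pair_mean (splice ?us ?vs)"
      by (simp only: pair_mean_def map_splice list.map fst_conv)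
    also have "\<dots> = pair_mean (map (\<lambda>x. (x, 0)) (map fst ps) @ (x, u) # (x, v) # ps)"
    proof (rule pair_mean_perm)
      show m: "mset (splice ?us ?vs) = mset (map (\<lambda>x. (x, 0)) (map fst ps) @ (x, u) # (x, v) # ps)"
        by (simp add: mset_splice zs_def comp_def)
      show "admissible (splice ?us ?vs)" unfolding admissible_perm[OF m]
        using assms(1-3) 3 s0 by (auto simp: admissible_def comp_def)
    qed
    also have "\<dots> = pair_mean ((x, u) # (x, v) # ps)"
      by (rule pair_mean_zeros) (use assms(1-3) 3 s0 in \<open>auto simp: admissible_def\<close>)
    finally show ?thesis by simp
  qed
qed

text \<open>The slots \<open>(x, g x)\<close>, one for each value, act as an accumulator: by
  \<open>pair_mean_split\<close> the weight of the head of \<open>ps\<close> moves into the slot of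
  its value, hence the induction over arbitrary \<open>g\<close>.\<close>

lemma pair_mean_collapse:
  assumes "admissible (ps @ map (\<lambda>x. (x, g x)) vs)" "fst ` set ps \<subseteq> set vs" "distinct vs"
  shows "pair_mean (ps @ map (\<lambda>x. (x, g x)) vs) = pair_mean (map (\<lambda>x. (x, weight_at ps x + g x)) vs)"
  using assms(1,2)
proof (induction ps arbitrary: g)
  case Nil
  then show ?case by (simp add: weight_at_def)
next
  case (Cons p ps)
  obtain x w where p: "p = (x, w)" by force
  from Cons.prems p obtain as bs where vs: "vs = as @ x # bs" by (auto dest: split_list)
  define h where "h = g(x := w + g x)"
  have xn: "x \<notin> set as" "x \<notin> set bs" using assms(3) vs by auto
  have h: "map (\<lambda>x. (x, h x)) as = map (\<lambda>x. (x, g x)) as" "map (\<lambda>x. (x, h x)) bs = map (\<lambda>x. (x, g x)) bs"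
    "h x = w + g x" using xn by (auto simp: h_def)
  let ?r = "ps @ map (\<lambda>x. (x, g x)) as @ map (\<lambda>x. (x, g x)) bs"
  have m1: "mset ((p # ps) @ map (\<lambda>x. (x, g x)) vs) = mset ((x, w) # (x, g x) # ?r)"
    by (simp add: p vs)
  have m2: "mset ((x, w + g x) # ?r) = mset (ps @ map (\<lambda>x. (x, h x)) vs)"
    unfolding vs map_append list.map h by simp
  have a1: "admissible ((x, w) # (x, g x) # ?r)"
    using Cons.prems(1) admissible_perm[OF m1] by blast
  then have a2: "admissible ((x, w + g x) # ?r)" 
    by (auto simp: admissible_def add.assoc)
  have "pair_mean ((p # ps) @ map (\<lambda>x. (x, g x)) vs) = pair_mean ((x, w) # (x, g x) # ?r)"
    by (rule pair_mean_perm[OF Cons.prems(1) m1])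
  also have "\<dots> = pair_mean ((x, w + g x) # ?r)"
    using a1 by (intro pair_mean_split a2) (auto simp: admissible_def)
  also have "\<dots> = pair_mean (ps @ map (\<lambda>x. (x, h x)) vs)"
    by (rule pair_mean_perm[OF a2 m2])
  also have "\<dots> = pair_mean (map (\<lambda>x. (x, weight_at ps x + h x)) vs)"
    using Cons.prems(2) admissible_perm[OF m2] a2 by (intro Cons.IH) auto
  also have "(\<lambda>x. (x, weight_at ps x + h x)) = (\<lambda>x. (x, weight_at (p # ps) x + g x))"
    by (auto simp: weight_at_def h_def p)
  finally show ?case .
qed

text \<open>Adding slots of weight zero for all values of both lists and then collapsing brings the
  two lists to the same normal form.\<close>

lemma pair_mean_eqI:
  assumes "admissible ps" "admissible qs" "\<And>v. weight_at ps v = weight_at qs v"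
  shows "pair_mean ps = pair_mean qs"
proof -
  obtain vs where vs: "set vs = fst ` set ps \<union> fst ` set qs" "distinct vs"
    using finite_distinct_list[of "fst ` set ps \<union> fst ` set qs"] by auto
  have vI: "set vs \<subseteq> I" using vs assms by (auto simp: admissible_def)
  have *: "pair_mean rs = pair_mean (map (\<lambda>x. (x, weight_at rs x)) vs)"
    if a: "admissible rs" and sub: "fst ` set rs \<subseteq> set vs" for rs
  proof -
    have m: "mset (rs @ map (\<lambda>x. (x, 0)) vs) = mset (map (\<lambda>x. (x, 0)) vs @ rs)" by simp
    have a': "admissible (rs @ map (\<lambda>x. (x, 0)) vs)"
      using a vI by (auto simp: admissible_def comp_def)
    show ?thesis
      using pair_mean_zeros[OF a vI] pair_mean_perm[OF a' m] pair_mean_collapse[OF a' sub vs(2)] by simp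
  qed
  show ?thesis using *[OF assms(1)] *[OF assms(2)] vs(1) assms(3) by simp
qed

end

subsection \<open>Jensen inequality and merging of points\<close>

lemma sum_lessThan_add:
  fixes f :: "nat \<Rightarrow> 'a::comm_monoid_add"
  shows "sum f {..<m + n} = sum f {..<m} + (\<Sum>i<n. f (i + m))"
  by (induction n) (auto simp: add_ac)

lemma sum_if_less:
  assumes "a \<le> b"
  shows "(\<Sum>s<b. if s < a then x else y) = real a * x + real (b - a) * (y :: real)"
proof -
  have "(\<Sum>s<a + (b - a). if s < a then x else y) = real a * x + real (b - a) * y"
    by (simp add: sum_lessThan_add)
  then show ?thesis using assms by simp
qed

text \<open>Increasing the shift by one moves the first term to the end. This is why, over all
  rotations, every entry visits a given position once.\<close>

lemma sum_shift_mod: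
  fixes f :: "nat \<Rightarrow> 'a::comm_monoid_add"
  assumes "0 < b"
  shows "(\<Sum>s<b. f ((s + i) mod b)) = (\<Sum>s<b. f s)"
proof (induction i)
  case 0
  show ?case by (rule sum.cong) auto
next
  case (Suc i)
  obtain c where b: "b = Suc c" using assms by (cases b) auto
  have "(\<Sum>s<b. f ((s + Suc i) mod b)) = (\<Sum>s<c. f ((Suc s + i) mod b)) + f (i mod b)"
    using mod_add_self2[of i b] by (simp add: b add.commute[of c] del: mod_add_self2)
  also have "\<dots> = (\<Sum>s<b. f ((s + i) mod b))"
    unfolding b by (subst sum.lessThan_Suc_shift) (simp add: add_ac)
  finally show ?case using Suc.IH by simp
qed

lemma mset_rotate: "mset (rotate n xs) = mset xs"
proof (induction n)
  case (Suc n)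
  have "mset (rotate1 ys) = mset ys" for ys :: "'a list" by (cases ys) auto
  then show ?case using Suc by simp
qed simp

lemma Rats_unit_intervalE:
  assumes "t \<in> \<rat>" "0 \<le> t" "t \<le> (1::real)"
  obtains a b :: nat where "a \<le> b" "0 < b" "t = real a / real b"
proof -
  obtain a b :: nat where "b \<noteq> 0" "\<bar>t\<bar> = real a / real b"
    using Rats_abs_nat_div_natE[OF assms(1)] by metis
  then show ?thesis using assms that[of a b] by (simp add: divide_le_eq_1)
qed

lemma convex_average:
  fixes C :: "real set"
  assumes "convex C" "0 < n" "\<And>s. s < n \<Longrightarrow> z s \<in> C"
  shows "(\<Sum>s<n. z s) / real n \<in> C"
proof -
  have "(\<Sum>s<n. (1 / real n) *\<^sub>R z s) \<in> C"
    using assms by (intro convex_sum) auto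
  then show ?thesis by (simp add: sum_divide_distrib)
qed

lemma convex_weighted:
  fixes C :: "real set"
  assumes "convex C" "x \<in> C" "y \<in> C" "0 \<le> u" "0 \<le> v" "0 < u + v" "(u + v) * z = u * x + v * y"
  shows "z \<in> C"
proof -
  have "(u / (u + v)) *\<^sub>R x + (v / (u + v)) *\<^sub>R y \<in> C"
    using assms by (intro convexD) (auto simp: add_divide_distrib[symmetric])
  moreover have "(u / (u + v)) *\<^sub>R x + (v / (u + v)) *\<^sub>R y = z"
    using assms(6,7) by (simp add: add_divide_distrib[symmetric] divide_eq_eq mult.commute)
  ultimately show ?thesis by simp
qed

text \<open>
  Averages of $2^k$ functions come from iterating the midpoint inequality; other lengths are
  padded with copies of the average itself.
\<close>
lemma midpoint_concave_average:
  fixes F :: "('i \<Rightarrow> real) \<Rightarrow> real"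
  assumes C: "convex C"
    and mid: "\<And>f g. (\<forall>i\<in>S. f i \<in> C) \<Longrightarrow> (\<forall>i\<in>S. g i \<in> C) \<Longrightarrow> (F f + F g) / 2 \<le> F (\<lambda>i. (f i + g i) / 2)"
    and n: "0 < n" and Z: "\<And>s. s < n \<Longrightarrow> \<forall>i\<in>S. Z s i \<in> C"
  shows "(\<Sum>s<n. F (Z s)) / real n \<le> F (\<lambda>i. (\<Sum>s<n. Z s i) / real n)"
proof -
  have dyadic: "(\<Sum>s<2^k. F (Y s)) / 2^k \<le> F (\<lambda>i. (\<Sum>s<2^k. Y s i) / 2^k)"
    if "\<And>s. s < 2^k \<Longrightarrow> \<forall>i\<in>S. Y s i \<in> C" for k :: nat and Y :: "nat \<Rightarrow> 'i \<Rightarrow> real"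
    using that
  proof (induction k arbitrary: Y)
    case (Suc k)
    let ?f = "\<lambda>i. (\<Sum>s<2^k. Y s i) / 2^k" and ?g = "\<lambda>i. (\<Sum>s<2^k. Y (s + 2^k) i) / 2^k"
    have 1: "\<forall>i\<in>S. ?f i \<in> C" "\<forall>i\<in>S. ?g i \<in> C"
      using convex_average[OF C, of "2^k"] Suc.prems by auto
    have split: "sum h {..<2 ^ Suc k} = sum h {..<2^k} + (\<Sum>s<2^k. h (s + 2^k))" for h :: "nat \<Rightarrow> real"
      using sum_lessThan_add[of h "2^k" "2^k"] by (simp add: mult_2)
    have "(\<Sum>s<2^Suc k. F (Y s)) / 2^Suc k =
        ((\<Sum>s<2^k. F (Y s)) / 2^k + (\<Sum>s<2^k. F (Y (s + 2^k))) / 2^k) / 2"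
      unfolding split by (simp add: field_simps)
    also have "\<dots> \<le> (F ?f + F ?g) / 2"
      by (intro divide_right_mono add_mono Suc.IH) (use Suc.prems in auto)
    also have "\<dots> \<le> F (\<lambda>i. (?f i + ?g i) / 2)" using 1 by (rule mid)
    also have "(\<lambda>i. (?f i + ?g i) / 2) = (\<lambda>i. (\<Sum>s<2^Suc k. Y s i) / 2^Suc k)"
      unfolding split by (simp add: field_simps)
    finally show ?case .
  qed simp
  define av where "av = (\<lambda>i. (\<Sum>s<n. Z s i) / real n)"
  define Y where "Y s = (if s < n then Z s else av)" for s
  have av: "\<forall>i\<in>S. av i \<in> C"
    unfolding av_def using convex_average[OF C n] Z by auto
  \<comment> \<open>\<open>2 ^ n\<close> serves as a power of two that is at least \<open>n\<close>.
    The \<open>m\<close> padding terms contribute \<open>real m * F av\<close> to the sum and cancel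
    at the end.\<close>
  define m where "m = 2 ^ n - n"
  have m: "2 ^ n = n + m" using less_exp[of n] by (simp add: m_def)
  have m': "2 ^ n = real n + real m" using arg_cong[OF m, of real] by simp
  have "(\<Sum>s<2^n. Y s i) = (\<Sum>s<n. Z s i) + real m * av i" for i
    unfolding m sum_lessThan_add by (simp add: Y_def)
  then have *: "(\<Sum>s<2^n. Y s i) / 2^n = av i" for i
    unfolding m' using n by (simp add: av_def field_simps)
  have "(\<Sum>s<2^n. F (Y s)) = (\<Sum>s<n. F (Z s)) + real m * F av"
    unfolding m sum_lessThan_add by (simp add: Y_def)
  then have "((\<Sum>s<n. F (Z s)) + real m * F av) / (real n + real m) \<le> F av"
    using dyadic[of n Y] Z av unfolding * by (simp add: Y_def m')
  then have "(\<Sum>s<n. F (Z s)) / real n \<le> F av"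
    using n by (simp add: field_simps)
  then show ?thesis by (simp add: av_def)
qed

section \<open>Concavity and merging for means of weighted points\<close>

context concave_mean
begin

lemma pair_mean_midpoint:
  assumes "admissible (map (\<lambda>i. (f i, w i)) is)" "\<forall>i\<in>set is. g i \<in> I"
  shows "(pair_mean (map (\<lambda>i. (f i, w i)) is) + pair_mean (map (\<lambda>i. (g i, w i)) is)) / 2
    \<le> pair_mean (map (\<lambda>i. ((f i + g i) / 2, w i)) is)"
proof -
  have a: "admissible (map (\<lambda>i. (g i, w i)) is)"
    using assms by (simp add: admissible_def comp_def)
  have "map2 (\<lambda>x y. (x + y) / 2) (map f is) (map g is) = map (\<lambda>i. (f i + g i) / 2) is"
    by (auto intro!: nth_equalityI)
  moreover have "map f is \<in> vectors I (length is)" "map g is \<in> vectors I (length is)"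
    "map w is \<in> weight_vectors \<rat> (length is)"
    using admissible_vectors[OF a] admissible_vectors[OF assms(1)] by (simp_all add: comp_def)
  ultimately show ?thesis
    using conc unfolding jensen_concave_mean_def pair_mean_def by (fastforce simp: comp_def)
qed

lemma pair_mean_average:
  assumes "0 < n" "\<And>s. s < n \<Longrightarrow> admissible (map (\<lambda>i. (Z s i, w i)) is)"
  shows "(\<Sum>s<n. pair_mean (map (\<lambda>i. (Z s i, w i)) is)) / real n
    \<le> pair_mean (map (\<lambda>i. ((\<Sum>s<n. Z s i) / real n, w i)) is)"
proof (rule midpoint_concave_average[where F = "\<lambda>f. pair_mean (map (\<lambda>i. (f i, w i)) is)"
      and S = "set is", OF conv _ assms(1)])
  show "\<forall>i\<in>set is. Z s i \<in> I" if "s < n" for s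
    using assms(2)[OF that] by (auto simp: admissible_def)
  fix f g :: "'a \<Rightarrow> real"
  assume f: "\<forall>i\<in>set is. f i \<in> I" and g: "\<forall>i\<in>set is. g i \<in> I"
  have "admissible (map (\<lambda>i. (f i, w i)) is)"
    using f assms(2)[OF assms(1)] by (simp add: admissible_def comp_def)
  then show "(pair_mean (map (\<lambda>i. (f i, w i)) is) + pair_mean (map (\<lambda>i. (g i, w i)) is)) / 2
    \<le> pair_mean (map (\<lambda>i. ((f i + g i) / 2, w i)) is)"
    using g by (rule pair_mean_midpoint)
qed

text \<open>For \<open>t = a / b\<close>, average \<open>a\<close> copies of \<open>f\<close> and
  \<open>b - a\<close> copies of \<open>g\<close>.\<close>

lemma pair_mean_rational_concave:
  assumes "admissible (map (\<lambda>i. (f i, w i)) is)" "\<forall>i\<in>set is. g i \<in> I"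
    and t: "t \<in> \<rat>" "0 \<le> t" "t \<le> 1"
  shows "t * pair_mean (map (\<lambda>i. (f i, w i)) is) + (1 - t) * pair_mean (map (\<lambda>i. (g i, w i)) is)
    \<le> pair_mean (map (\<lambda>i. (t * f i + (1 - t) * g i, w i)) is)"
proof -
  obtain a b :: nat where ab: "a \<le> b" "0 < b" "t = real a / real b" using Rats_unit_intervalE[OF t] .
  have *: "(\<Sum>s<b. if s < a then x else y) / real b = t * x + (1 - t) * y" for x y :: real
    unfolding sum_if_less[OF ab(1)] ab(3) using ab(1,2)
    by (simp add: add_divide_distrib of_nat_diff diff_divide_distrib left_diff_distrib)
  define Z where "Z s i = (if s < a then f i else g i)" for s :: nat and i
  have "(\<Sum>s<b. pair_mean (map (\<lambda>i. (Z s i, w i)) is)) / real b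
      \<le> pair_mean (map (\<lambda>i. ((\<Sum>s<b. Z s i) / real b, w i)) is)"
    using assms(1,2) by (intro pair_mean_average ab(2)) (auto simp: Z_def admissible_def comp_def)
  moreover have "(\<Sum>s<b. pair_mean (map (\<lambda>i. (Z s i, w i)) is)) =
      (\<Sum>s<b. if s < a then pair_mean (map (\<lambda>i. (f i, w i)) is) else pair_mean (map (\<lambda>i. (g i, w i)) is))"
    by (rule sum.cong) (auto simp: Z_def)
  ultimately show ?thesis by (simp add: Z_def *)
qed

text \<open>
  Split the two pairs into equally weighted copies of x and y and average over the cyclic
  rotations of these copies: each rotation has the same mean, by symmetry.
\<close>
lemma pair_mean_merge:
  assumes a: "admissible ((x, u) # (y, v) # ps)"
    and uv: "0 < u + v" and z: "(u + v) * z = u * x + v * y"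
  shows "pair_mean ((x, u) # (y, v) # ps) \<le> pair_mean ((z, u + v) # ps)"
proof -
  have uv0: "u \<in> \<rat>" "v \<in> \<rat>" "0 \<le> u" "0 \<le> v" "x \<in> I" "y \<in> I" using a by (auto simp: admissible_def)
  then obtain p b :: nat where pb: "p \<le> b" "0 < b" "u / (u + v) = real p / real b"
    using Rats_unit_intervalE[of "u / (u + v)"] uv by (auto simp: field_simps)
  \<comment> \<open>The common unit of weight: \<open>u = p * h\<close> and
    \<open>v = (b - p) * h\<close>, which is possible since \<open>u / (u + v)\<close> is
    rational.\<close>
  define h where "h = (u + v) / real b"
  have h: "h \<in> \<rat>" "0 < h" using uv0 uv pb by (auto simp: h_def)
  have hb: "real b * h = u + v" using pb by (simp add: h_def)
  have hp: "real p * h = u" using pb uv by (simp add: h_def field_simps)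
  have hq: "real (b - p) * h = v" using hb hp pb(1) by (simp add: of_nat_diff algebra_simps)
  define zs where "zs = replicate p x @ replicate (b - p) y"
  have zs: "length zs = b" "set zs \<subseteq> I" using pb uv0 by (auto simp: zs_def)
  \<comment> \<open>The tags separate the \<open>b\<close> positions that are rotated from the
    points of \<open>ps\<close>, which stay fixed, so that one index list serves all
    rotations.\<close>
  define js where "js = map Inl [0..<b] @ map Inr ps"
  define Z where "Z s = case_sum (\<lambda>i. rotate s zs ! i) (fst :: real \<times> real \<Rightarrow> real)" for s
  define w where "w = case_sum (\<lambda>i::nat. h) (snd :: real \<times> real \<Rightarrow> real)"
  have js: "map (\<lambda>i. (Z s i, w i)) js = map (\<lambda>z. (z, h)) (rotate s zs) @ ps" for s
    unfolding js_def Z_def w_def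
    by (simp add: comp_def) (rule nth_equalityI, auto simp: zs)
  have js_const: "map (\<lambda>i. (case_sum (\<lambda>i. z) fst i, w i)) js = replicate b (z, h) @ ps" for z
    unfolding js_def w_def by (simp add: comp_def map_replicate_const)
  have s0: "sum_list (map snd ps) \<ge> 0"
    using a by (auto simp: admissible_def intro!: sum_list_nonneg)
  have hz: "sum_list (map (\<lambda>z. h) zs) = u + v" by (simp add: sum_list_triv zs hb)
  have adm0: "admissible (map (\<lambda>z. (z, h)) zs @ ps)"
    using a zs h hz uv s0 by (auto simp: admissible_def comp_def)
  have m: "mset (map (\<lambda>z. (z, h)) zs @ ps) = mset (map (\<lambda>i. (Z s i, w i)) js)" for s
    unfolding js by (simp add: mset_rotate)
  have adm: "admissible (map (\<lambda>i. (Z s i, w i)) js)" for s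
    using adm0 admissible_perm[OF m] by blast
  have rot: "pair_mean (map (\<lambda>i. (Z s i, w i)) js) = pair_mean (map (\<lambda>z. (z, h)) zs @ ps)" for s
    by (rule pair_mean_perm[OF adm0 m, symmetric])
  have spread: "pair_mean (map (\<lambda>z. (z, h)) zs @ ps) = pair_mean ((x, u) # (y, v) # ps)"
    by (rule pair_mean_eqI[OF adm0 a])
      (auto simp: weight_at_def zs_def comp_def sum_list_replicate hp hq)
  have zI: "z \<in> I" using convex_weighted[OF conv uv0(5,6,3,4) uv z] .
  \<comment> \<open>As \<open>s\<close> runs over all rotations, position \<open>i\<close> meets
    every entry of \<open>zs\<close> once, so its average is the barycentre
    \<open>z\<close>.\<close>
  have "(\<Sum>s<b. Z s (Inl i)) / real b = z" if "i < b" for i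
  proof -
    have "(\<Sum>s<b. Z s (Inl i)) = (\<Sum>s<b. zs ! ((s + i) mod b))"
      using that by (simp add: Z_def nth_rotate zs)
    also have "\<dots> = sum_list zs"
      unfolding sum_shift_mod[OF pb(2)] by (simp add: sum_list_sum_nth zs atLeast0LessThan)
    also have "\<dots> = real p * x + real (b - p) * y" by (simp add: zs_def sum_list_replicate)
    finally have "h * (\<Sum>s<b. Z s (Inl i)) = (real p * h) * x + (real (b - p) * h) * y"
      by (simp add: algebra_simps)
    also have "\<dots> = (real b * h) * z" using z by (simp add: hp hq hb)
    also have "\<dots> = h * (real b * z)" by simp
    finally show ?thesis using h pb by simp
  qed
  moreover have "(\<Sum>s<b. Z s (Inr p)) / real b = fst p" for p
    using pb by (simp add: Z_def)
  ultimately have avg: "map (\<lambda>i. ((\<Sum>s<b. Z s i) / real b, w i)) js = map (\<lambda>i. (case_sum (\<lambda>i. z) fst i, w i)) js"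
    by (auto simp: js_def)
  have "pair_mean ((x, u) # (y, v) # ps) = (\<Sum>s<b. pair_mean (map (\<lambda>i. (Z s i, w i)) js)) / real b"
    unfolding rot spread using pb by simp
  also have "\<dots> \<le> pair_mean (map (\<lambda>i. ((\<Sum>s<b. Z s i) / real b, w i)) js)"
    by (rule pair_mean_average[OF pb(2) adm])
  also have "\<dots> = pair_mean (replicate b (z, h) @ ps)" by (simp only: avg js_const)
  also have "\<dots> = pair_mean ((z, u + v) # ps)"
    by (rule pair_mean_eqI)
      (use a zI h hb uv s0 uv0 in \<open>auto simp: admissible_def weight_at_def sum_list_replicate\<close>)
  finally show ?thesis .
qed

text \<open>Pairs are merged one at a time; each merged point moves into \<open>ps\<close>, which is
  therefore arbitrary in the induction.\<close>

lemma pair_mean_merge_list: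
  assumes "admissible (concat (map (\<lambda>j. [(x j, u j), (y j, v j)]) js) @ ps)"
    and "\<And>j. j \<in> set js \<Longrightarrow> 0 < u j + v j"
    and "\<And>j. j \<in> set js \<Longrightarrow> (u j + v j) * z j = u j * x j + v j * y j"
  shows "pair_mean (concat (map (\<lambda>j. [(x j, u j), (y j, v j)]) js) @ ps)
    \<le> pair_mean (map (\<lambda>j. (z j, u j + v j)) js @ ps)"
  using assms
proof (induction js arbitrary: ps)
  case (Cons j js)
  let ?c = "concat (map (\<lambda>j. [(x j, u j), (y j, v j)]) js)"
  have a: "admissible ((x j, u j) # (y j, v j) # ?c @ ps)" using Cons.prems(1) by simp
  have uv: "0 < u j + v j" "(u j + v j) * z j = u j * x j + v j * y j" using Cons.prems by auto
  have "z j \<in> I"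
    by (rule convex_weighted[OF conv _ _ _ _ uv]) (use a in \<open>auto simp: admissible_def\<close>)
  then have a': "admissible ((z j, u j + v j) # ?c @ ps)"
    using a by (auto simp: admissible_def)
  have m: "mset ((z j, u j + v j) # ?c @ ps) = mset (?c @ (z j, u j + v j) # ps)" by simp
  have a'': "admissible (?c @ (z j, u j + v j) # ps)" using a' admissible_perm[OF m] by blast
  have "pair_mean (concat (map (\<lambda>j. [(x j, u j), (y j, v j)]) (j # js)) @ ps)
      \<le> pair_mean ((z j, u j + v j) # ?c @ ps)"
    using pair_mean_merge[OF a uv] by simp
  also have "\<dots> = pair_mean (?c @ (z j, u j + v j) # ps)"
    by (rule pair_mean_perm[OF a' m])
  also have "\<dots> \<le> pair_mean (map (\<lambda>j. (z j, u j + v j)) js @ (z j, u j + v j) # ps)"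
    using Cons.prems by (intro Cons.IH a'') auto
  also have "\<dots> = pair_mean (map (\<lambda>j. (z j, u j + v j)) (j # js) @ ps)"
  proof (rule pair_mean_perm)
    have mem: "x k \<in> I" "y k \<in> I" "u k \<in> \<rat>" "v k \<in> \<rat>" "0 \<le> u k" "0 \<le> v k"
      if "k \<in> set js" for k
    proof -
      let ?r = "?c @ (z j, u j + v j) # ps"
      have k: "(x k, u k) \<in> set ?r" "(y k, v k) \<in> set ?r" using that by auto
      have "\<forall>p\<in>set ?r. fst p \<in> I \<and> snd p \<in> \<rat> \<and> 0 \<le> snd p"
        using a'' unfolding admissible_def by blast
      from bspec[OF this k(1)] bspec[OF this k(2)]
      show "x k \<in> I" "y k \<in> I" "u k \<in> \<rat>" "v k \<in> \<rat>" "0 \<le> u k" "0 \<le> v k" by simp_all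
    qed
    have zI: "z k \<in> I" if "k \<in> set js" for k
      using convex_weighted[OF conv, of "x k" "y k" "u k" "v k"] mem[OF that]
        Cons.prems(2,3)[of k] that by simp
    have s: "sum_list (map snd ?c) = (\<Sum>k\<leftarrow>js. u k + v k)"
      by (induction js) auto
    show "admissible (map (\<lambda>j. (z j, u j + v j)) js @ (z j, u j + v j) # ps)"
    proof -
      have "u k + v k \<in> \<rat> \<and> 0 \<le> u k + v k" if "k \<in> set js" for k
        using mem[OF that] by simp
      moreover have "0 < (\<Sum>k\<leftarrow>js. u k + v k) + (u j + v j + sum_list (map snd ps))"
        using a'' s unfolding admissible_def map_append sum_list_append by simp
      moreover have "\<forall>p\<in>set ((z j, u j + v j) # ps). fst p \<in> I \<and> snd p \<in> \<rat> \<and> 0 \<le> snd p"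
        using a'' unfolding admissible_def set_append by blast
      ultimately show ?thesis using zI by (auto simp: admissible_def comp_def)
    qed
  qed simp
  finally show ?case .
qed simp

end

subsection \<open>A Kedlaya inequality\<close>

lemma weight_at_map_upt:
  "weight_at (map (\<lambda>j. (f j, w j)) [0..<m]) v = (\<Sum>j<m. if f j = v then w j else 0)"
  by (simp add: weight_at_def comp_def interv_sum_list_conv_sum_set_nat atLeast0LessThan cong: if_cong)

lemma weight_at_concat_upt:
  "weight_at (concat (map (\<lambda>j. [(f j, u j), (g j, w j)]) [0..<m])) v
    = (\<Sum>j<m. (if f j = v then u j else 0)) + (\<Sum>j<m. (if g j = v then w j else 0))"
  by (induction m) (auto simp: weight_at_def)

lemma sum_list_snd_concat_upt:
  "sum_list (map snd (concat (map (\<lambda>j. [(f j, u j), (g j, w j)]) [0..<m])))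
    = (\<Sum>j<m. u j + w j :: real)"
  by (induction m) auto

section \<open>Weight sequences and the means of prefixes\<close>

locale concave_mean_weights = concave_mean +
  fixes l :: "nat \<Rightarrow> real"
  assumes V: "l \<in> V \<rat>"
begin

definition total :: "nat \<Rightarrow> real" where
  "total n = (\<Sum>k\<le>n. l k)"

definition arith_mean :: "(nat \<Rightarrow> real) \<Rightarrow> nat \<Rightarrow> real" where
  "arith_mean x n = (\<Sum>k\<le>n. l k * x k) / total n"

definition wmean :: "(nat \<Rightarrow> real) \<Rightarrow> nat \<Rightarrow> real" where
  "wmean x n = M (prefix x (Suc n)) (prefix l (Suc n))"

lemma weight_rat: "l n \<in> \<rat>"
  using V by (auto simp: V_def)

lemma weight0_pos: "0 < l 0"
  using V by (simp add: V_def)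

lemma weight_nonneg: "0 \<le> l n"
  using V by (cases n) (auto simp: V_def)

lemma total_pos: "0 < total n"
  unfolding total_def using weight0_pos weight_nonneg by (intro sum_pos2[of _ 0]) auto

lemma total_Suc: "total (Suc n) = total n + l (Suc n)"
  by (simp add: total_def)

lemma total_mono: "m \<le> n \<Longrightarrow> total m \<le> total n"
  unfolding total_def using weight_nonneg by (intro sum_mono2) auto

lemma total_rat: "total n \<in> \<rat>"
  unfolding total_def using weight_rat by (intro Rats_sum) auto

lemma ratio_antimono: "m \<le> n \<Longrightarrow> l n / total n \<le> l m / total m"
  using V unfolding V_def total_def decseq_def by blast

text \<open>A ratio \<open>l n / total n\<close> is positive exactly when its weight is, so once a
  weight vanishes all later ones do.\<close>

lemma weight_pos_antimono:
  assumes "0 < l n" "m \<le> n" shows "0 < l m"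
proof -
  have "0 < l n / total n" using assms(1) total_pos by simp
  also have "\<dots> \<le> l m / total m" using assms(2) by (rule ratio_antimono)
  finally show ?thesis using total_pos[of m] by (simp add: zero_less_divide_iff)
qed

lemma wmean_eq: "wmean x n = pair_mean (map (\<lambda>j. (x j, l j)) [0..<Suc n])"
  unfolding wmean_def pair_mean_def prefix_def by (simp add: comp_def)

lemma wmean_cong: "(\<And>j. j \<le> n \<Longrightarrow> x j = y j) \<Longrightarrow> wmean x n = wmean y n"
  unfolding wmean_def prefix_def by (intro arg_cong2[of _ _ _ _ M] map_cong) auto

lemma admissible_weights:
  assumes "\<And>j. j \<le> n \<Longrightarrow> x j \<in> I"
  shows "admissible (map (\<lambda>j. (x j, l j)) [0..<Suc n])"
proof -
  have "sum_list (map l [0..<Suc n]) = total n"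
    by (simp only: interv_sum_list_conv_sum_set_nat total_def set_upt atLeast0LessThan lessThan_Suc_atMost)
  then have "sum_list (map snd (map (\<lambda>j. (x j, l j)) [0..<Suc n])) = total n"
    by (simp add: comp_def)
  then show ?thesis using assms weight_rat weight_nonneg total_pos by (auto simp: admissible_def)
qed

lemma wmean_rational_concave:
  assumes "\<And>j. j \<le> n \<Longrightarrow> x j \<in> I" "\<And>j. j \<le> n \<Longrightarrow> y j \<in> I" "t \<in> \<rat>" "0 \<le> t" "t \<le> 1"
  shows "t * wmean x n + (1 - t) * wmean y n \<le> wmean (\<lambda>j. t * x j + (1 - t) * y j) n"
  unfolding wmean_eq using assms by (intro pair_mean_rational_concave admissible_weights) auto

lemma arith_mean_in:
  assumes "\<And>j. j \<le> n \<Longrightarrow> x j \<in> I" shows "arith_mean x n \<in> I"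
proof -
  have "(\<Sum>k\<le>n. (l k / total n) *\<^sub>R x k) \<in> I"
    using assms weight_nonneg total_pos[of n] conv
    by (intro convex_sum) (auto simp: sum_divide_distrib[symmetric] total_def)
  then show ?thesis by (simp add: arith_mean_def sum_divide_distrib)
qed

lemma total_arith_mean: "total n * arith_mean x n = (\<Sum>k\<le>n. l k * x k)"
  using total_pos[of n] by (simp add: arith_mean_def)

text \<open>
  Put e = l (n + 1) / total (n + 1). The vector of arithmetic means A j up to n + 1 equals
  e x j + (1 - e) B j, where B j is obtained by merging A j and A (j - 1) with weights
  l j - e * total j and e * total (j - 1); these are nonnegative by the monotonicity of the ratios.
  Before merging, the weights of A j telescope to l j for j \<open>\<le>\<close> n and to 0 for j = n + 1.
\<close>
lemma kedlaya_step:
  assumes x: "\<And>j. x j \<in> I"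
  shows "total n * wmean (arith_mean x) n + l (Suc n) * wmean x (Suc n)
    \<le> total (Suc n) * wmean (arith_mean x) (Suc n)"
proof (cases "l (Suc n) = 0")
  case True
  have "wmean (arith_mean x) (Suc n) = wmean (arith_mean x) n"
    unfolding wmean_eq
    by (rule pair_mean_eqI)
      (use True in \<open>auto intro!: admissible_weights arith_mean_in x simp: weight_at_map_upt simp del: upt_Suc\<close>)
  then show ?thesis using True by (simp add: total_Suc)
next
  case False
  \<comment> \<open>Positivity of the last weight passes to all earlier ones, so that every merged
    weight \<open>q * l j\<close> will be positive.\<close>
  then have pos: "0 < l j" if "j \<le> Suc n" for j
    using weight_pos_antimono[OF _ that] weight_nonneg[of "Suc n"] by simp
  define A where "A = arith_mean x"
  define e where "e = l (Suc n) / total (Suc n)"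
  define q where "q = total n / total (Suc n)"
  define u where "u j = l j - e * total j" for j
  \<comment> \<open>The sum over \<open>i < j\<close> is \<open>total (j - 1)\<close> for positive
    \<open>j\<close> and 0 for \<open>j = 0\<close>, where the truncated \<open>A (j - 1)\<close>
    therefore carries no weight.\<close>
  define v where "v j = e * (\<Sum>i<j. l i)" for j
  define B where "B j = (A j - e * x j) / q" for j
  have AI: "A j \<in> I" for j unfolding A_def using x by (rule arith_mean_in)
  have eq: "e = 1 - q" "0 < q" "q \<in> \<rat>" "e \<in> \<rat>" "0 < e" "e \<le> 1"
    using total_pos[of n] total_pos[of "Suc n"] total_rat weight_rat pos[of "Suc n"]
    by (auto simp: e_def q_def total_Suc field_simps)
  have uv: "u j + v j = q * l j" for j
    by (simp add: u_def v_def eq(1) total_def lessThan_Suc_atMost[symmetric] algebra_simps)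
  have u0: "0 \<le> u j" if "j \<le> Suc n" for j
    using ratio_antimono[OF that] total_pos[of j] by (simp add: u_def e_def pos_le_divide_eq)
  have v0: "0 \<le> v j" for j
    using eq weight_nonneg by (simp add: v_def sum_nonneg)
  have rat: "u j \<in> \<rat>" "v j \<in> \<rat>" for j
    unfolding u_def v_def using eq(4) weight_rat total_rat
    by (intro Rats_diff Rats_mult Rats_sum; simp)+
  have merge: "(u j + v j) * B j = u j * A j + v j * A (j - 1)" for j
  proof -
    have 1: "(\<Sum>i<j. l i) * A (j - 1) = (\<Sum>i<j. l i * x i)"
    proof (cases j)
      case (Suc i)
      then show ?thesis using total_arith_mean[of i x]
        by (simp add: A_def total_def lessThan_Suc_atMost)
    qed simp
    have 2: "total j * A j = (\<Sum>i<j. l i * x i) + l j * x j"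
      using total_arith_mean[of j x] by (simp add: A_def lessThan_Suc_atMost[symmetric])
    have "u j * A j + v j * A (j - 1) = l j * A j - e * (total j * A j) + e * ((\<Sum>i<j. l i) * A (j - 1))"
      by (simp add: u_def v_def algebra_simps)
    also have "\<dots> = l j * (A j - e * x j)"
      unfolding 1 2 by (simp add: algebra_simps)
    finally show ?thesis unfolding uv B_def using eq(2) by simp
  qed
  have uv0: "0 < u j + v j" if "j \<le> Suc n" for j
    unfolding uv using pos[OF that] eq by simp
  have BI: "B j \<in> I" if "j \<le> Suc n" for j
    using convex_weighted[OF conv AI AI u0[OF that] v0 uv0[OF that] merge] .
  let ?pairs = "concat (map (\<lambda>j. [(A j, u j), (A (j - 1), v j)]) [0..<Suc (Suc n)])"
  have adm: "admissible ?pairs"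
  proof -
    have "0 < (\<Sum>j<Suc (Suc n). u j + v j)" using uv0 by (intro sum_pos) auto
    then show ?thesis using AI u0 v0 rat
      unfolding admissible_def sum_list_snd_concat_upt by auto
  qed
  have tele: "pair_mean ?pairs = wmean A n"
    unfolding wmean_eq
  proof (rule pair_mean_eqI[OF adm])
    show "admissible (map (\<lambda>j. (A j, l j)) [0..<Suc n])" using AI by (rule admissible_weights)
    fix t
    have un: "u (Suc n) = 0" using total_pos[of "Suc n"] by (simp add: u_def e_def)
    have "(\<Sum>j<Suc (Suc n). if A (j - 1) = t then v j else 0)
        = (\<Sum>j<Suc n. if A j = t then e * total j else 0)"
      by (subst sum.lessThan_Suc_shift) (simp add: v_def total_def lessThan_Suc_atMost cong: if_cong)
    then have "weight_at ?pairs t = (\<Sum>j<Suc n. if A j = t then u j else 0)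
        + (\<Sum>j<Suc n. if A j = t then e * total j else 0)"
      unfolding weight_at_concat_upt by (subst sum.lessThan_Suc) (simp add: un)
    also have "\<dots> = (\<Sum>j<Suc n. if A j = t then l j else 0)"
      unfolding sum.distrib[symmetric] by (intro sum.cong) (auto simp: u_def)
    finally show "weight_at ?pairs t = weight_at (map (\<lambda>j. (A j, l j)) [0..<Suc n]) t"
      unfolding weight_at_map_upt .
  qed
  have "wmean A n \<le> pair_mean (map (\<lambda>j. (B j, u j + v j)) [0..<Suc (Suc n)])"
    using pair_mean_merge_list[of A u "\<lambda>j. A (j - 1)" v "[0..<Suc (Suc n)]" "[]" B,
        unfolded append_Nil2, OF adm uv0 merge]
    unfolding tele by (simp del: upt_Suc)
  \<comment> \<open>All merged weights are \<open>q * l j\<close>, and nullhomogeneity removes the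
    rational factor \<open>q\<close>.\<close>
  also have "\<dots> = pair_mean (map (\<lambda>p. (fst p, q * snd p)) (map (\<lambda>j. (B j, l j)) [0..<Suc (Suc n)]))"
    by (simp add: uv comp_def)
  also have "\<dots> = wmean B (Suc n)"
    unfolding wmean_eq using BI eq by (intro pair_mean_scale admissible_weights) auto
  finally have step: "wmean A n \<le> wmean B (Suc n)" .
  have "e * wmean x (Suc n) + (1 - e) * wmean B (Suc n) \<le> wmean (\<lambda>j. e * x j + (1 - e) * B j) (Suc n)"
    using x BI eq by (intro wmean_rational_concave) auto
  also have "(\<lambda>j. e * x j + (1 - e) * B j) = A"
    using eq by (auto simp: B_def fun_eq_iff)
  finally have "e * wmean x (Suc n) + q * wmean B (Suc n) \<le> wmean A (Suc n)"
    by (simp add: eq(1))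
  moreover have "q * wmean A n \<le> q * wmean B (Suc n)"
    using step eq(2) by (intro mult_left_mono) auto
  ultimately have "e * wmean x (Suc n) + q * wmean A n \<le> wmean A (Suc n)"
    by linarith
  then have "total (Suc n) * (e * wmean x (Suc n) + q * wmean A n) \<le> total (Suc n) * wmean A (Suc n)"
    using total_pos[of "Suc n"] by simp
  then show ?thesis
    using total_pos[of "Suc n"] by (simp add: e_def q_def A_def algebra_simps)
qed

lemma kedlaya:
  assumes "\<And>j. x j \<in> I"
  shows "(\<Sum>i\<le>n. l i * wmean x i) \<le> total n * wmean (arith_mean x) n"
proof (induction n)
  case 0
  have "wmean (arith_mean x) 0 = wmean x 0"
    using weight0_pos by (intro wmean_cong) (simp add: arith_mean_def total_def)
  then show ?case by (simp add: total_def)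
next
  case (Suc n)
  then show ?case using kedlaya_step[of x n] assms by simp
qed

end

subsection \<open>Hardy constants\<close>

lemma prefix_update: "k < n \<Longrightarrow> prefix (f(k := u)) n = (prefix f n)[k := u]"
  by (rule nth_equalityI) (auto simp: prefix_def nth_list_update)

lemma le_if_le_add_small:
  fixes a b k \<delta>\<^sub>0 :: real
  assumes "0 < \<delta>\<^sub>0" "0 < k" "\<And>\<delta>. 0 < \<delta> \<Longrightarrow> \<delta> \<le> \<delta>\<^sub>0 \<Longrightarrow> a \<le> b + \<delta> * k"
  shows "a \<le> b"
proof (rule field_le_epsilon)
  fix e :: real assume "0 < e"
  have "a \<le> b + min \<delta>\<^sub>0 (e / k) * k" using assms \<open>0 < e\<close> by (intro assms(3)) auto
  also have "min \<delta>\<^sub>0 (e / k) * k \<le> e" using assms(2) by (simp add: min_def field_simps)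
  finally show "a \<le> b + e" by simp
qed

text \<open>\<open>nonneg\<close> and \<open>downward\<close> record what infimum 0 gives for an
  interval; they leave open whether 0 belongs to it.\<close>

locale hardy_mean = concave_mean_weights +
  assumes mono: "monotone_mean \<rat> I M"
    and nonneg: "x \<in> I \<Longrightarrow> 0 \<le> x"
    and downward: "p \<in> I \<Longrightarrow> 0 < z \<Longrightarrow> z \<le> p \<Longrightarrow> z \<in> I"
begin

section \<open>Monotonicity and bounds for the means of prefixes\<close>

lemma prefix_vectors:
  assumes "\<And>j. j \<le> n \<Longrightarrow> x j \<in> I"
  shows "prefix x (Suc n) \<in> vectors I (Suc n)" "prefix l (Suc n) \<in> weight_vectors \<rat> (Suc n)"
  using admissible_vectors[OF admissible_weights, of n x] assms by (simp_all add: prefix_def comp_def)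

text \<open>Monotonicity is given for one variable at a time; the hybrids \<open>z k\<close> replace
  the entries one after another.\<close>

lemma wmean_mono:
  assumes "\<And>j. j \<le> n \<Longrightarrow> x j \<in> I" "\<And>j. j \<le> n \<Longrightarrow> y j \<in> I" "\<And>j. j \<le> n \<Longrightarrow> x j \<le> y j"
  shows "wmean x n \<le> wmean y n"
proof -
  define z where "z k = (\<lambda>j. if j < k then y j else x j)" for k
  have "wmean x n \<le> wmean (z k) n" if "k \<le> Suc n" for k
    using that
  proof (induction k)
    case (Suc k)
    have "prefix (z k) (Suc n) ! k \<le> y k" "k < Suc n" "y k \<in> I"
      using assms Suc.prems by (auto simp: z_def prefix_def simp del: upt_Suc)
    moreover have "\<And>j. j \<le> n \<Longrightarrow> z k j \<in> I" using assms by (simp add: z_def)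
    ultimately have "wmean (z k) n \<le> M ((prefix (z k) (Suc n))[k := y k]) (prefix l (Suc n))"
      using mono prefix_vectors[of n "z k"] unfolding monotone_mean_def wmean_def by blast
    also have "(prefix (z k) (Suc n))[k := y k] = prefix (z (Suc k)) (Suc n)"
      unfolding prefix_update[OF \<open>k < Suc n\<close>, symmetric]
      by (intro arg_cong[of _ _ "\<lambda>f. prefix f (Suc n)"]) (auto simp: z_def fun_eq_iff less_Suc_eq)
    finally show ?case using Suc by (simp add: wmean_def)
  qed (simp add: z_def)
  from this[of "Suc n"] show ?thesis using wmean_cong[of n "z (Suc n)" y] by (simp add: z_def)
qed

lemma wmean_in:
  assumes "\<And>j. j \<le> n \<Longrightarrow> x j \<in> I" shows "wmean x n \<in> I"
  unfolding wmean_def using prefix_vectors[of n x, OF assms] by (rule mean_in)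

lemma wmean_bounds:
  assumes "\<And>j. j \<le> n \<Longrightarrow> x j \<in> I"
  shows "(\<And>j. j \<le> n \<Longrightarrow> c \<le> x j) \<Longrightarrow> c \<le> wmean x n"
    and "(\<And>j. j \<le> n \<Longrightarrow> x j \<le> c) \<Longrightarrow> wmean x n \<le> c"
proof -
  have *: "Min (set (prefix x (Suc n))) \<le> wmean x n \<and> wmean x n \<le> Max (set (prefix x (Suc n)))"
    unfolding wmean_def using prefix_vectors[of n x, OF assms] mean_bounds by blast
  have set: "set (prefix x (Suc n)) = x ` {..n}"
    unfolding prefix_def by (simp only: set_map set_upt atLeast0LessThan lessThan_Suc_atMost)
  show "c \<le> wmean x n" if "\<And>j. j \<le> n \<Longrightarrow> c \<le> x j"
  proof -
    have "c \<le> Min (x ` {..n})" using that by (subst Min_ge_iff) auto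
    then show ?thesis using * unfolding set by linarith
  qed
  show "wmean x n \<le> c" if "\<And>j. j \<le> n \<Longrightarrow> x j \<le> c"
  proof -
    have "Max (x ` {..n}) \<le> c" using that by (subst Max_le_iff) auto
    then show ?thesis using * unfolding set by linarith
  qed
qed

section \<open>The supremum defining the constant\<close>

lemma C_const_eq:
  "C_const I M l = (SUP y\<in>{y. 0 < y \<and> (\<forall>k. y / total k \<in> I)}.
      liminf (\<lambda>n. ereal (total n / y * wmean (\<lambda>k. y / total k) n)))"
  unfolding C_const_def total_def wmean_def ..

lemma quotient_in:
  assumes "0 < y" "y / l 0 \<in> I" shows "y / total k \<in> I"
proof (rule downward[OF assms(2)])
  have "l 0 \<le> total k" using total_mono[of 0 k] by (simp add: total_def)
  then show "y / total k \<le> y / l 0" using assms(1) weight0_pos by (intro divide_left_mono) auto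
qed (use assms total_pos in auto)

text \<open>The least entry is \<open>y / total n\<close>, so by the mean value property every term
  of the liminf is at least 1.\<close>

lemma liminf_ge_1:
  assumes y: "0 < y" "y / l 0 \<in> I"
  shows "1 \<le> liminf (\<lambda>n. ereal (total n / y * wmean (\<lambda>k. y / total k) n))"
proof -
  have "1 \<le> total n / y * wmean (\<lambda>k. y / total k) n" for n
  proof -
    have "y / total n \<le> wmean (\<lambda>k. y / total k) n"
      using quotient_in[OF y] y(1) total_pos total_mono
      by (intro wmean_bounds(1)) (auto intro!: divide_left_mono)
    then show ?thesis using y(1) total_pos[of n] by (simp add: field_simps)
  qed
  then show ?thesis by (intro Liminf_bounded) simp
qed

lemma C_const_ge_1:
  assumes "p \<in> I" "0 < p" shows "1 \<le> C_const I M l"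
proof -
  let ?y = "p * l 0"
  have y: "0 < ?y" "?y / l 0 \<in> I" using assms weight0_pos by auto
  note liminf_ge_1[OF y]
  also have "liminf (\<lambda>n. ereal (total n / ?y * wmean (\<lambda>k. ?y / total k) n)) \<le> C_const I M l"
    unfolding C_const_eq using y quotient_in[OF y] by (intro SUP_upper) auto
  finally show ?thesis .
qed

section \<open>Upper bound for the Hardy constant\<close>

lemma term_nonneg: "(\<And>j. x j \<in> I) \<Longrightarrow> 0 \<le> l n * wmean x n"
  using wmean_in nonneg weight_nonneg by simp

text \<open>The partial sum up to \<open>N\<close> is fixed while \<open>n\<close> grows: being
  below the \<open>n\<close>-th term for all \<open>n\<close> at least \<open>N\<close>, it is below
  the liminf for this \<open>y\<close>.\<close>

lemma hardy_small_sum: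
  assumes x: "\<And>j. x j \<in> I" and y: "0 < y" "y / l 0 \<in> I"
    and sum: "\<And>n. (\<Sum>i\<le>n. l i * x i) \<le> y"
  shows "ereal ((\<Sum>i<N. l i * wmean x i) / y) \<le> C_const I M l"
proof -
  have "(\<Sum>i<N. l i * wmean x i) / y \<le> total n / y * wmean (\<lambda>k. y / total k) n" if "N \<le> n" for n
  proof -
    have "(\<Sum>i<N. l i * wmean x i) \<le> (\<Sum>i\<le>n. l i * wmean x i)"
      using that term_nonneg[OF x] by (intro sum_mono2) auto
    also have "\<dots> \<le> total n * wmean (arith_mean x) n" using x by (rule kedlaya)
    also have "\<dots> \<le> total n * wmean (\<lambda>k. y / total k) n"
    proof (intro mult_left_mono wmean_mono)
      show "arith_mean x j \<le> y / total j" for j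
        unfolding arith_mean_def using sum total_pos[of j] by (intro divide_right_mono) auto
    qed (use x arith_mean_in quotient_in[OF y] total_pos[of n] in auto)
    finally show ?thesis using y(1) by (simp add: field_simps)
  qed
  then have "ereal ((\<Sum>i<N. l i * wmean x i) / y)
      \<le> liminf (\<lambda>n. ereal (total n / y * wmean (\<lambda>k. y / total k) n))"
    by (intro Liminf_bounded) (auto simp: eventually_sequentially)
  also have "\<dots> \<le> C_const I M l"
    unfolding C_const_eq using y quotient_in[OF y] by (intro SUP_upper) auto
  finally show ?thesis .
qed

text \<open>Positive tail entries can lie in \<open>I\<close> even when 0 does not. The summand 1 in
  \<open>l j + 1\<close> avoids division by zero and keeps the weighted tail below a geometric
  series.\<close>

definition small_tail :: "(nat \<Rightarrow> real) \<Rightarrow> nat \<Rightarrow> real \<Rightarrow> nat \<Rightarrow> real" where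
  "small_tail x N \<delta> j = (if j < N then x j else \<delta> / (2 ^ j * (l j + 1)))"

lemma small_tail_in:
  assumes "\<And>j. x j \<in> I" "\<delta> \<in> I" "0 < \<delta>" shows "small_tail x N \<delta> j \<in> I"
proof -
  have "1 \<le> 2 ^ j * (l j + 1)"
    using mult_mono[of 1 "2 ^ j :: real" 1 "l j + 1"] weight_nonneg[of j] by simp
  then have "0 < \<delta> / (2 ^ j * (l j + 1))" "\<delta> / (2 ^ j * (l j + 1)) \<le> \<delta>"
    using assms(3) by (simp_all add: divide_le_eq)
  then show ?thesis using assms downward by (simp add: small_tail_def)
qed

lemma small_tail_sum:
  assumes x: "\<And>j. x j \<in> I" and "0 < \<delta>"
  shows "(\<Sum>i<m. l i * small_tail x N \<delta> i) \<le> (\<Sum>i<N. l i * x i) + 2 * \<delta>"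
proof -
  have nn: "0 \<le> l i * x i" for i using x nonneg weight_nonneg by simp
  have "l i * small_tail x N \<delta> i \<le> (if i < N then l i * x i else 0) + \<delta> / 2 ^ i" for i
  proof (cases "i < N")
    case False
    have "l i * (\<delta> / (2 ^ i * (l i + 1))) = (l i / (l i + 1)) * (\<delta> / 2 ^ i)" by simp
    also have "\<dots> \<le> 1 * (\<delta> / 2 ^ i)"
      using weight_nonneg[of i] assms(2) by (intro mult_right_mono) auto
    finally show ?thesis using False by (simp add: small_tail_def)
  qed (use assms(2) in \<open>simp add: small_tail_def\<close>)
  then have "(\<Sum>i<m. l i * small_tail x N \<delta> i)
      \<le> (\<Sum>i<m. if i < N then l i * x i else 0) + (\<Sum>i<m. \<delta> / 2 ^ i)"
    unfolding sum.distrib[symmetric] by (intro sum_mono)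
  also have "(\<Sum>i<m. if i < N then l i * x i else 0) = (\<Sum>i\<in>{..<m} \<inter> {..<N}. l i * x i)"
    by (simp add: sum.inter_restrict)
  also have "\<dots> \<le> (\<Sum>i<N. l i * x i)" using nn by (intro sum_mono2) auto
  also have "(\<Sum>i<m. \<delta> / 2 ^ i) = 2 * \<delta> - 2 * \<delta> / 2 ^ m" by (induction m) (auto simp: field_simps)
  finally show ?thesis using assms(2) by (smt (verit) divide_nonneg_pos zero_less_power)
qed

text \<open>
  The estimate for small sums needs y / l 0 in I. It is reached by contracting the first N entries
  towards a small positive constant, which concavity controls from below, and by letting the
  remaining entries decay fast.
\<close>
lemma hardy_partial_sum:
  assumes x: "\<And>j. x j \<in> I" and p: "p \<in> I" "0 < p" and c: "C_const I M l \<le> ereal c"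
  shows "(\<Sum>i<N. l i * wmean x i) \<le> c * (\<Sum>i<N. l i * x i)"
proof -
  define s where "s = (\<Sum>i<N. l i * x i)"
  \<comment> \<open>The total coefficient of \<delta>: contraction adds at most \<delta> times the
    sum of the first \<open>N\<close> weights, and the tail adds at most
    \<open>2 * \<delta>\<close>.\<close>
  define K where "K = (\<Sum>i<N. l i) + 2"
  have s: "0 \<le> s" unfolding s_def using x nonneg weight_nonneg by (intro sum_nonneg) simp
  have K: "0 < K" unfolding K_def using weight_nonneg by (smt (verit) sum_nonneg)
  have c1: "1 \<le> c" using order_trans[OF C_const_ge_1[OF p] c] by simp
  \<comment> \<open>\<open>t\<close> is the reciprocal of an integer because concavity is at hand
    for rational factors. It makes \<open>t * s\<close> at most half of \<open>l 0 * p\<close>; the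
    bound on \<delta> leaves the other half to \<open>\<delta> * K\<close>.\<close>
  obtain b :: nat where b: "2 * s / (l 0 * p) < real b" using reals_Archimedean2 by blast
  define t where "t = 1 / real (Suc b)"
  have t: "t \<in> \<rat>" "0 < t" "t \<le> 1" by (auto simp: t_def)
  have lp: "0 < l 0 * p" using weight0_pos p by simp
  have ts: "t * s \<le> l 0 * p / 2"
  proof -
    have "2 * s < real b * (l 0 * p)" using b lp by (simp add: pos_divide_less_eq)
    also have "\<dots> \<le> real (Suc b) * (l 0 * p)" using lp by (intro mult_right_mono) auto
    finally show ?thesis by (simp add: t_def field_simps)
  qed
  \<comment> \<open>With \<open>t\<close> fixed, \<delta> tends to 0; afterwards \<open>t\<close>
    cancels.\<close>
  have "t * (\<Sum>i<N. l i * wmean x i) \<le> c * (t * s)"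
  proof (rule le_if_le_add_small[of "min p (l 0 * p / (2 * K))" "c * K"])
    show "0 < min p (l 0 * p / (2 * K))" using lp K p by simp
    show "0 < c * K" using K c1 by simp
    fix \<delta> assume \<delta>: "0 < \<delta>" "\<delta> \<le> min p (l 0 * p / (2 * K))"
    have \<delta>I: "\<delta> \<in> I" using downward[OF p(1)] \<delta> by simp
    have \<delta>K: "\<delta> * K \<le> l 0 * p / 2" using \<delta> K by (simp add: field_simps)
    \<comment> \<open>The contraction is towards \<delta> instead of 0, since 0 may lie outside
      \<open>I\<close>.\<close>
    define z where "z = (\<lambda>j. t * x j + (1 - t) * \<delta>)"
    define y where "y = t * s + \<delta> * K"
    have zI: "z j \<in> I" for j
      using convexD[OF conv x \<delta>I, of t "1 - t"] t by (simp add: z_def)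
    have y: "0 < y" "y \<le> l 0 * p" using s t \<delta> K \<delta>K ts by (auto simp: y_def add_nonneg_pos)
    have yI: "y / l 0 \<in> I"
      using y weight0_pos by (intro downward[OF p(1)]) (auto simp: field_simps)
    let ?w = "small_tail z N \<delta>"
    have wI: "?w j \<in> I" for j using zI \<delta>I \<delta>(1) by (rule small_tail_in)
    have "(\<Sum>i<N. l i * z i) = t * s + (1 - t) * (\<delta> * (\<Sum>i<N. l i))"
      by (simp add: z_def s_def sum.distrib sum_subtractf sum_distrib_left algebra_simps)
    also have "\<dots> \<le> t * s + 1 * (\<delta> * (\<Sum>i<N. l i))"
      using t \<delta> weight_nonneg by (intro add_left_mono mult_right_mono) (auto intro!: mult_nonneg_nonneg sum_nonneg)
    finally have "(\<Sum>i<N. l i * z i) + 2 * \<delta> \<le> y" by (simp add: y_def K_def algebra_simps)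
    then have "(\<Sum>i\<le>n. l i * ?w i) \<le> y" for n
      using small_tail_sum[where x = z and m = "Suc n" and N = N, OF zI \<delta>(1)] by (simp only: lessThan_Suc_atMost)
    from hardy_small_sum[where x = ?w and N = N, OF wI y(1) yI this] c
    have "ereal ((\<Sum>i<N. l i * wmean ?w i) / y) \<le> ereal c" by (rule order_trans)
    then have *: "(\<Sum>i<N. l i * wmean ?w i) \<le> c * y" using y(1) by (simp add: pos_divide_le_eq)
    have "t * wmean x i \<le> wmean ?w i" if "i < N" for i
    proof -
      have "t * wmean x i + (1 - t) * wmean (\<lambda>_. \<delta>) i \<le> wmean z i"
        unfolding z_def using x \<delta>I t by (intro wmean_rational_concave) auto
      moreover have "0 \<le> (1 - t) * wmean (\<lambda>_. \<delta>) i"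
        using wmean_in[of i "\<lambda>_. \<delta>"] \<delta>I nonneg t by simp
      moreover have "wmean z i = wmean ?w i"
        using that by (intro wmean_cong) (simp add: small_tail_def)
      ultimately show ?thesis by linarith
    qed
    then have "t * (\<Sum>i<N. l i * wmean x i) \<le> (\<Sum>i<N. l i * wmean ?w i)"
      unfolding sum_distrib_left using weight_nonneg
      by (intro sum_mono) (auto simp: mult.left_commute[of t] intro!: mult_left_mono)
    with * show "t * (\<Sum>i<N. l i * wmean x i) \<le> c * (t * s) + \<delta> * (c * K)"
      by (simp add: y_def algebra_simps)
  qed
  then show ?thesis using t by (simp add: s_def)
qed

lemma hardy_constant_eq:
  "hardy_constant I M l = Inf {C. \<forall>x. range x \<subseteq> I \<longrightarrow>
      (\<Sum>n. ereal (l n * wmean x n)) \<le> C * (\<Sum>n. ereal (l n * x n))}"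
  unfolding hardy_constant_def wmean_def ..

lemma hardy_constant_le:
  assumes p: "p \<in> I" "0 < p"
  shows "hardy_constant I M l \<le> C_const I M l"
  unfolding hardy_constant_eq
proof (intro Inf_lower CollectI allI impI)
  fix x :: "nat \<Rightarrow> real" assume "range x \<subseteq> I"
  then have x: "x j \<in> I" for j by auto
  define S where "S = (\<Sum>n. ereal (l n * x n))"
  have nn: "0 \<le> ereal (l n * x n)" for n using x nonneg weight_nonneg by simp
  have part: "ereal (\<Sum>n<N. l n * x n) \<le> S" for N
    using suminf_upper[of "\<lambda>n. ereal (l n * x n)" N] nn by (simp add: S_def)
  have C1: "1 \<le> C_const I M l" using C_const_ge_1[OF p] .
  have bound: "(\<Sum>n. ereal (l n * wmean x n)) \<le> b"
    if "\<And>N. ereal (\<Sum>n<N. l n * wmean x n) \<le> b" for b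
    using that term_nonneg[OF x] by (intro suminf_bound) auto
  show "(\<Sum>n. ereal (l n * wmean x n)) \<le> C_const I M l * S"
  proof (cases "C_const I M l")
    case (real c)
    show ?thesis
    proof (rule bound)
      fix N
      have "ereal (\<Sum>n<N. l n * wmean x n) \<le> ereal c * ereal (\<Sum>n<N. l n * x n)"
        using hardy_partial_sum[where x = x and c = c and N = N, OF x p] real by simp
      also have "\<dots> \<le> ereal c * S"
        using C1 real part[of N] by (intro ereal_mult_left_mono) auto
      finally show "ereal (\<Sum>n<N. l n * wmean x n) \<le> C_const I M l * S" using real by simp
    qed
  next
    \<comment> \<open>Since infinity times 0 is 0, an infinite constant settles the claim at once
      only if \<open>S\<close> is not 0. For \<open>S = 0\<close> all terms on the left must
      vanish.\<close>
    case PInf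
    show ?thesis
    proof (cases "S = 0")
      case True
      have lx: "l n * x n = 0" for n
      proof -
        have "(\<Sum>k<Suc n. l k * x k) \<le> 0" using part[of "Suc n"] True by (simp del: sum.lessThan_Suc)
        moreover have "l n * x n \<le> (\<Sum>k<Suc n. l k * x k)"
          using nn by (intro member_le_sum) auto
        ultimately have "l n * x n \<le> 0" by linarith
        moreover have "0 \<le> l n * x n" using nn[of n] by simp
        ultimately show ?thesis by (rule antisym)
      qed
      have "l n * wmean x n = 0" for n
      proof (cases "l n = 0")
        case False
        \<comment> \<open>A positive weight \<open>l n\<close> makes all earlier weights positive,
          so \<open>x\<close> vanishes up to \<open>n\<close>, and the mean value property makes the
          mean vanish too.\<close>
        then have "x j = 0" if "j \<le> n" for j
          using lx[of j] weight_pos_antimono[OF _ that] weight_nonneg[of n] by fastforce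
        then have "wmean x n \<le> 0" by (intro wmean_bounds(2)[where x = x and n = n, OF x]) auto
        then show ?thesis using wmean_in[of n x] x nonneg by fastforce
      qed simp
      then have "(\<lambda>n. ereal (l n * wmean x n)) = (\<lambda>_. 0)" by (simp only: zero_ereal_def)
      then show ?thesis using True by simp
    next
      case False
      have "0 \<le> S" using part[of 0] by (simp add: zero_ereal_def)
      then show ?thesis using False PInf by simp
    qed
  qed (use C1 in simp)
qed

section \<open>Sharpness for divergent weights\<close>

text \<open>The Abel-Dini argument: the terms from \<open>Suc m\<close> to \<open>N\<close> sum to
  at least \<open>1 - total m / total N\<close>, hence to at least 1/2 once \<open>total N\<close>
  exceeds twice \<open>total m\<close>. A convergent series has no such blocks for large
  \<open>m\<close>.\<close>

lemma ratio_sums_unbounded: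
  assumes "(\<Sum>n. ereal (l n)) = \<infinity>"
  obtains N where "B < (\<Sum>n<N. l n / total n)"
proof (rule ccontr)
  assume "\<not> thesis"
  then have le: "(\<Sum>n<N. l n / total n) \<le> B" for N using that not_le by blast
  have nn: "0 \<le> l n / total n" for n using weight_nonneg total_pos[of n] by simp
  have summ: "summable (\<lambda>n. l n / total n)"
    using nn le by (rule summableI_nonneg_bounded)
  let ?S = "\<Sum>n. l n / total n"
  from summable_LIMSEQ[OF summ] have "\<forall>\<^sub>F n in sequentially. ?S - 1 / 2 < (\<Sum>k<n. l k / total k)"
    by (rule order_tendstoD) simp
  then obtain m where m: "?S - 1 / 2 < (\<Sum>k<m. l k / total k)"
    by (auto simp: eventually_sequentially)
  obtain N where N: "2 * total m < (\<Sum>k<N. l k)"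
  proof (rule ccontr)
    assume "\<not> thesis"
    then have "(\<Sum>k<N. l k) \<le> 2 * total m" for N using that not_le by blast
    then have "(\<Sum>n. ereal (l n)) \<le> ereal (2 * total m)"
      using weight_nonneg by (intro suminf_bound) auto
    then show False using assms by simp
  qed
  have sum_le_total: "(\<Sum>k<j. l k) \<le> total j" for j
    unfolding total_def using weight_nonneg by (intro sum_mono2) auto
  have "m < N"
  proof (rule ccontr)
    assume "\<not> m < N"
    then have "(\<Sum>k<N. l k) \<le> total m"
      using sum_le_total[of N] total_mono[of N m] by linarith
    then show False using N total_pos[of m] by linarith
  qed
  have "total N = (\<Sum>k<N. l k) + l N" by (simp add: total_def lessThan_Suc_atMost[symmetric])
  then have tN: "2 * total m < total N" using N weight_nonneg[of N] by linarith
  have 1: "(\<Sum>k<Suc N. l k / total k) = (\<Sum>k<Suc m. l k / total k) + (\<Sum>k=Suc m..<Suc N. l k / total k)"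
    using \<open>m < N\<close> by (simp only: atLeast0LessThan[symmetric] sum.atLeastLessThan_concat)
  have 2: "(\<Sum>k=Suc m..<Suc N. l k / total N) \<le> (\<Sum>k=Suc m..<Suc N. l k / total k)"
    using weight_nonneg total_pos total_mono by (intro sum_mono divide_left_mono) auto
  have 3: "(\<Sum>k=Suc m..<Suc N. l k / total N) = (total N - total m) / total N"
  proof -
    have "total N = total m + (\<Sum>k=Suc m..<Suc N. l k)"
      using \<open>m < N\<close> unfolding total_def lessThan_Suc_atMost[symmetric]
      by (simp only: atLeast0LessThan[symmetric] sum.atLeastLessThan_concat)
    then show ?thesis by (simp add: sum_divide_distrib[symmetric] del: sum.op_ivl_Suc)
  qed
  have "(\<Sum>k<Suc m. l k / total k) + (total N - total m) / total N \<le> (\<Sum>k<Suc N. l k / total k)"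
    using 1 2 3 by linarith
  moreover have "1 / 2 \<le> (total N - total m) / total N"
    using tN total_pos[of N] by (simp add: field_simps)
  moreover have "(\<Sum>k<Suc N. l k / total k) \<le> ?S"
    using nn by (intro sum_le_suminf summ) auto
  moreover have "(\<Sum>k<Suc m. l k / total k) = (\<Sum>k<m. l k / total k) + l m / total m"
    by (rule sum.lessThan_Suc)
  ultimately show False using m nn[of m] by linarith
qed

text \<open>If an admissible \<open>C\<close> were below the liminf for some \<open>y\<close>,
  constants \<open>c1 < c2\<close> strictly between them would bound the partial sums of
  \<open>l k / total k\<close>, against their divergence.\<close>

lemma C_const_le_hardy_constant:
  assumes div: "(\<Sum>n. ereal (l n)) = \<infinity>"
  shows "C_const I M l \<le> hardy_constant I M l"
  unfolding hardy_constant_eq C_const_eq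
proof (intro Inf_greatest SUP_least)
  fix C y
  assume C: "C \<in> {C. \<forall>x. range x \<subseteq> I \<longrightarrow>
      (\<Sum>n. ereal (l n * wmean x n)) \<le> C * (\<Sum>n. ereal (l n * x n))}"
    and yy: "y \<in> {y. 0 < y \<and> (\<forall>k. y / total k \<in> I)}"
  define q where "q = (\<lambda>k. y / total k)"
  define R where "R n = (\<Sum>k<n. l k / total k)" for n
  let ?L = "liminf (\<lambda>n. ereal (total n / y * wmean q n))"
  have y: "0 < y" and qI: "q k \<in> I" for k using yy by (auto simp: q_def)
  have y0: "y / l 0 \<in> I" using qI[of 0] by (simp add: q_def total_def)
  have L1: "1 \<le> ?L" unfolding q_def using y y0 by (rule liminf_ge_1)
  have "?L \<le> C"
  proof (rule ccontr)
    assume "\<not> ?L \<le> C"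
    moreover have "0 < ?L" using L1 by (rule less_le_trans[rotated]) simp
    ultimately have "max C 0 < ?L" by simp
    \<comment> \<open>\<open>C\<close> may be negative, even minus infinity; the maximum with 0
      ensures that \<open>c1\<close> and \<open>c2\<close> are positive.\<close>
    then obtain c2 where c2: "max C 0 < ereal c2" "ereal c2 < ?L" using ereal_dense2 by blast
    from c2(1) obtain c1 where c1: "max C 0 < ereal c1" "ereal c1 < ereal c2" using ereal_dense2 by blast
    have c: "0 < c1" "c1 < c2" "C \<le> ereal c1" using c1 by auto
    from less_LiminfD[OF c2(2)] obtain n0 where
      "\<And>n. n0 \<le> n \<Longrightarrow> ereal c2 < ereal (total n / y * wmean q n)"
      by (auto simp: eventually_sequentially)
    then have n0: "c2 * y * (l n / total n) \<le> l n * wmean q n" if "n0 \<le> n" for n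
    proof -
      have "c2 \<le> total n / y * wmean q n"
        using \<open>\<And>n. n0 \<le> n \<Longrightarrow> ereal c2 < ereal (total n / y * wmean q n)\<close>[OF that] by simp
      then have "c2 * y / total n \<le> wmean q n" using y total_pos[of n] by (simp add: field_simps)
      then have "l n * (c2 * y / total n) \<le> l n * wmean q n"
        using weight_nonneg by (intro mult_left_mono) auto
      then show ?thesis by (simp add: mult_ac)
    qed
    \<comment> \<open>The right-hand side is free of \<open>N\<close>, so this would bound the
      divergent sums \<open>R N\<close>.\<close>
    have R_bound: "(c2 - c1) * y * R N \<le> c2 * y * R n0 + c1 * 2 * (y / l 0)" for N
    proof -
      \<comment> \<open>The first \<open>N\<close> entries are \<open>y / total k\<close>; the tail
        adds at most \<open>2 * (y / l 0)\<close> to the weighted sum, whatever \<open>N\<close>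
        is.\<close>
      define x where "x = small_tail q N (y / l 0)"
      have \<delta>: "0 < y / l 0" using y weight0_pos by simp
      have xI: "x j \<in> I" for j unfolding x_def using qI y0 \<delta> by (rule small_tail_in)
      have nn: "0 \<le> ereal (l n * x n)" for n using xI nonneg weight_nonneg by simp
      \<comment> \<open>The lower bound for \<open>l n * wmean q n\<close> starts at
        \<open>n0\<close>; the earlier part is absorbed in \<open>c2 * y * R n0\<close>.\<close>
      have "c2 * y * R N \<le> c2 * y * R n0 + (\<Sum>n<N. l n * wmean q n)"
      proof (induction N)
        case 0
        show ?case using c c1 y weight_nonneg total_pos
          by (auto simp: R_def intro!: mult_nonneg_nonneg sum_nonneg divide_nonneg_pos)
      next
        case (Suc N)
        show ?case
        proof (cases "n0 \<le> N")
          case True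
          then show ?thesis using Suc n0[OF True] by (simp add: R_def algebra_simps)
        next
          case False
          have "R (Suc N) \<le> R n0"
            unfolding R_def using False weight_nonneg total_pos
            by (intro sum_mono2) (auto intro!: divide_nonneg_pos)
          then have "c2 * y * R (Suc N) \<le> c2 * y * R n0" using c y by (intro mult_left_mono) auto
          moreover have "0 \<le> (\<Sum>n<Suc N. l n * wmean q n)"
            using term_nonneg[OF qI] by (intro sum_nonneg) auto
          ultimately show ?thesis by linarith
        qed
      qed
      also have "(\<Sum>n<N. l n * wmean q n) = (\<Sum>n<N. l n * wmean x n)"
        by (intro sum.cong refl arg_cong2[of _ _ _ _ "(*)"] wmean_cong) (auto simp: x_def small_tail_def)
      finally have 1: "c2 * y * R N \<le> c2 * y * R n0 + (\<Sum>n<N. l n * wmean x n)" .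
      have "(\<Sum>n<N. l n * q n) = y * R N"
        by (simp add: q_def R_def sum_distrib_left mult_ac)
      then have part: "(\<Sum>n<m. l n * x n) \<le> y * R N + 2 * (y / l 0)" for m
        unfolding x_def using small_tail_sum[where x = q and m = m and N = N, OF qI \<delta>] by simp
      have "ereal (\<Sum>n<N. l n * wmean x n) \<le> (\<Sum>n. ereal (l n * wmean x n))"
        using suminf_upper[of "\<lambda>n. ereal (l n * wmean x n)" N] term_nonneg[OF xI] by simp
      also have "\<dots> \<le> C * (\<Sum>n. ereal (l n * x n))" using C xI by blast
      also have "\<dots> \<le> ereal c1 * (\<Sum>n. ereal (l n * x n))"
        using c nn by (intro ereal_mult_right_mono suminf_0_le) auto
      also have "\<dots> \<le> ereal c1 * ereal (y * R N + 2 * (y / l 0))"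
        using c part nn by (intro ereal_mult_left_mono suminf_bound) auto
      finally have "(\<Sum>n<N. l n * wmean x n) \<le> c1 * (y * R N + 2 * (y / l 0))" by simp
      with 1 show ?thesis by (simp add: algebra_simps)
    qed
    define K where "K = (c2 * y * R n0 + c1 * 2 * (y / l 0)) / ((c2 - c1) * y)"
    obtain N where "K < R N" unfolding R_def using ratio_sums_unbounded[OF div] .
    then show False using R_bound[of N] c y by (simp add: K_def pos_divide_less_eq mult.commute)
  qed
  then show "liminf (\<lambda>n. ereal (total n / y * wmean (\<lambda>k. y / total k) n)) \<le> C"
    by (simp add: q_def)
qed

text \<open>Both series vanish and minus infinity times 0 is 0, so minus infinity is an admissible
  constant. The supremum in \<open>C_const\<close> runs over the empty set.\<close>

lemma trivial_interval:
  assumes "I = {0}"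
  shows "hardy_constant I M l = -\<infinity>" "C_const I M l = -\<infinity>"
proof -
  have "-\<infinity> \<in> {C. \<forall>x. range x \<subseteq> I \<longrightarrow>
      (\<Sum>n. ereal (l n * wmean x n)) \<le> C * (\<Sum>n. ereal (l n * x n))}"
  proof (intro CollectI allI impI)
    fix x :: "nat \<Rightarrow> real" assume "range x \<subseteq> I"
    then have x: "x j = 0" for j using assms by auto
    then have "wmean x n = 0" for n using wmean_in[of n x] assms by simp
    then show "(\<Sum>n. ereal (l n * wmean x n)) \<le> -\<infinity> * (\<Sum>n. ereal (l n * x n))"
      using x by (simp add: zero_ereal_def[symmetric])
  qed
  from Inf_lower[OF this] show "hardy_constant I M l = -\<infinity>"
    unfolding hardy_constant_eq by simp
  have empty: "{y. 0 < y \<and> (\<forall>k. y / total k \<in> I)} = {}"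
    using assms total_pos by (auto dest: spec[of _ 0] simp: order_less_imp_not_eq2)
  then show "C_const I M l = -\<infinity>" unfolding C_const_eq empty by (simp add: bot_ereal_def)
qed

end

theorem corollary4p2:
  fixes I :: "real set" and M :: "real list \<Rightarrow> real list \<Rightarrow> real" and l :: "nat \<Rightarrow> real"
  assumes "is_interval I" and "I \<noteq> {}" and "bdd_below I" and "Inf I = 0"
    and "weighted_mean \<rat> I M"
    and "symmetric_mean \<rat> I M"
    and "monotone_mean \<rat> I M"
    and "jensen_concave_mean \<rat> I M"
    and "l \<in> V \<rat>"
  shows "hardy_constant I M l \<le> C_const I M l \<and>
    ((\<Sum>n. ereal (l n)) = \<infinity> \<longrightarrow> hardy_constant I M l = C_const I M l)"
proof -
  have nonneg: "0 \<le> x" if "x \<in> I" for x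
    using cInf_lower[OF that assms(3)] assms(4) by simp
  have downward: "z \<in> I" if z: "p \<in> I" "0 < z" "z \<le> p" for p z
  proof -
    \<comment> \<open>Infimum 0 gives a member of \<open>I\<close> below \<open>z\<close>, and the
      interval contains everything between it and \<open>p\<close>.\<close>
    obtain a where "a \<in> I" "a < z" using cInf_lessD[OF assms(2), of z] assms(4) z(2) by auto
    then show ?thesis using mem_is_interval_1_I[OF assms(1) _ z(1)] z(3) by simp
  qed
  have "convex I" using assms(1) by (rule is_interval_convex)
  then interpret hardy_mean I M l
    using assms nonneg downward by unfold_locales auto
  show ?thesis
  \<comment> \<open>The upper bound is proved from a positive point of \<open>I\<close>; without
    one, \<open>I\<close> is \<open>{0}\<close>.\<close>
  proof (cases "\<exists>p\<in>I. 0 < p")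
    case True
    then show ?thesis using hardy_constant_le C_const_le_hardy_constant by (auto intro: antisym)
  next
    case False
    then have "I = {0}" using nonneg assms(2) by (force simp: not_less)
    then show ?thesis using trivial_interval by simp
  qed
qed

end
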